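(* Let $(X,d)$ be a metric space, $Y$ a locally convex space, $K\subset Y$ a pointed convex cone specifying a partial order $\le_K$ on $Y$, and $H\subset K$ a nonempty $K$-convex set with $0\notin\mathrm{vcl}(H+K)$. Put $C_H:=H+K$. Let $f:X\to 2^Y$ be a set-valued map, $S$ a nonempty closed subset of $X$, $x_0\in S$, $\epsilon>0$, and let $\gamma>0$ be a constant. Suppose that the following conditions are satisfied: (i) $(X,d)$ is $(f,K)$-lower complete (or complete); (ii) $x_0\in AE(C_H,\epsilon)$; (iii') $f$ is $K$-slm, $f(x)\subset Y$ is weakly compact for all $x\in X$, $H$ is weakly compact and $K$ is closed. Then there exists $\bar x\in S$ such that (a) $f(x_0)\subset f(\bar x)+\gamma\, d(x_0,\bar x)H+K$; (b) $f(\bar x)\not\subset f(x)+\gamma\, d(\bar x,x)H+K$ for all $x\in S\setminus\{\bar x\}$; (c) $d(x_0,\bar x)\le\epsilon/\gamma$.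
   Context: A locally convex space is a real locally convex Hausdorff topological vector space; weakly compact means compact for the weak topology $\sigma(Y,Y^* )$. $2^Y$ is the family of all subsets of $Y$; for $A\subset X$, $f(A)=\bigcup_{x\in A}f(x)$. For $A,B\subset Y$ and $\alpha\in\mathbb R$, $A+B=\{a+b:a\in A,b\in B\}$ and $\alpha A=\{\alpha a:a\in A\}$. A cone is a nonempty set $K\subset Y$ with $\alpha K\subset K$ for all $\alpha\ge 0$; it is a convex cone if also $K+K\subset K$, and pointed if $K\cap(-K)=\{0\}$. Cones are always assumed nontrivial: $K\ne\{0\}$ and $K\ne Y$. The order is $y_1\le_K y_2\iff y_1-y_2\in -K$. A set $H$ is $K$-convex if $H+K$ is convex. For nonempty $A\subset Y$, the vector closure is $\mathrm{vcl}(A)=\{y\in Y:\exists v\in Y,\ \exists \lambda_n\ge 0,\ \lambda_n\to 0 \text{ with } y+\lambda_n v\in A\ \forall n\in\mathbb N\}$. $x_0\in AE(C_H,\epsilon)$ ($x_0$ is an $\epsilon$-efficient solution, in the sense of Németh with respect to $H$, of the problem of minimizing $f$ over $S$) means: $x_0\in S$ and there exists $y_0\in f(x_0)$ with $(f(S)-y_0)\cap(-\epsilon H-K)=\emptyset$. $f$ is $K$-slm ($K$-sequentially lower monotone) if for any sequence $(x_n)\subset X$ with $x_n\to\bar x\in X$ and $f(x_n)\subset f(x_{n+1})+K$ for all $n$, one has $f(x_n)\subset f(\bar x)+K$ for all $n$. $(X,d)$ is $(f,K)$-lower complete if every Cauchy sequence $(x_n)\subset X$ with $f(x_n)\subset f(x_{n+1})+K$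 for all $n$ converges to some point of $X$. *)

theory Defs
  imports "HOL-Analysis.Analysis" "HOL-Library.Set_Algebras"
begin

text \<open>Local convexity is spelled out because \<open>convex\<close> is not available inside a class
  specification; \<open>convex_nhds_base\<close> below restates it with \<open>convex\<close>.\<close>

class locally_convex_space = real_vector + topological_ab_group_add + t2_space +
  assumes tendsto_scaleR_nhds_Pair:
    "LIM p (nhds c \<times>\<^sub>F nhds x). fst p *\<^sub>R snd p :> nhds (c *\<^sub>R x)"
  and convex_nhds_base_unfolded:
    "open U \<Longrightarrow> 0 \<in> U \<Longrightarrow> \<exists>V. open V \<and>
       (\<forall>x\<in>V. \<forall>y\<in>V. \<forall>u\<ge>0. \<forall>v\<ge>0. u + v = 1 \<longrightarrow> u *\<^sub>R x + v *\<^sub>R y \<in> V) \<and> 0 \<in> V \<and> V \<subseteq> U"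

lemma convex_nhds_base:
  fixes U :: "'b::locally_convex_space set"
  assumes "open U" "0 \<in> U"
  shows "\<exists>V. open V \<and> convex V \<and> 0 \<in> V \<and> V \<subseteq> U"
  using convex_nhds_base_unfolded[OF assms] unfolding convex_def .

instance real_normed_vector \<subseteq> locally_convex_space
proof
  fix c :: real and x :: 'a
  show "LIM p (nhds c \<times>\<^sub>F nhds x). fst p *\<^sub>R snd p :> nhds (c *\<^sub>R x)"
    by (intro tendsto_scaleR filterlim_fst filterlim_snd)
next
  fix U :: "'a set"
  assume "open U" "0 \<in> U"
  then obtain e where "e > 0" "ball 0 e \<subseteq> U"
    by (meson open_contains_ball)
  then show "\<exists>V. open V \<and>
      (\<forall>x\<in>V. \<forall>y\<in>V. \<forall>u\<ge>0. \<forall>v\<ge>0. u + v = 1 \<longrightarrow> u *\<^sub>R x + v *\<^sub>R y \<in> V) \<and> 0 \<in> V \<and> V \<subseteq> U"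
    unfolding convex_def[symmetric] by (intro exI[of _ "ball 0 e"]) auto
qed

definition weak_topology :: "'b::locally_convex_space topology" where
  "weak_topology = topology_generated_by
     {l -` U | (l :: 'b \<Rightarrow> real) U. linear l \<and> continuous_on UNIV l \<and> open U}"

abbreviation weakly_compact :: "'b::locally_convex_space set \<Rightarrow> bool" where
  "weakly_compact A \<equiv> compactin weak_topology A"

text \<open>Cones are nontrivial by convention. The library's \<open>convex_cone\<close> already requires
  nonemptiness. Throughout, \<open>-\<close> on sets would denote the complement (or set difference),
  so the algebraic negative of \<open>K\<close> is written as an image.\<close>

definition pointed_convex_cone :: "'b::real_vector set \<Rightarrow> bool" where
  "pointed_convex_cone K \<longleftrightarrow>
     convex_cone K \<and> K \<inter> uminus ` K = {0} \<and> K \<noteq> {0} \<and> K \<noteq> UNIV"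

definition K_convex :: "'b::real_vector set \<Rightarrow> 'b set \<Rightarrow> bool" where
  "K_convex K H \<longleftrightarrow> convex (H + K)"

definition vcl :: "'b::real_vector set \<Rightarrow> 'b set" where
  "vcl A = {y. \<exists>v. \<exists>l :: nat \<Rightarrow> real.
     (\<forall>n. l n \<ge> 0) \<and> l \<longlonglongrightarrow> 0 \<and> (\<forall>n. y + l n *\<^sub>R v \<in> A)}"

text \<open>The set \<open>AE(C\<^sub>H, \<epsilon>)\<close> for minimizing \<open>f\<close> over \<open>S\<close>, where \<open>C\<^sub>H = H + K\<close>;
  the set of excluded differences \<open>-\<epsilon>H - K\<close> depends on \<open>H\<close> and \<open>K\<close> separately.\<close>

definition eps_efficient ::
  "('a \<Rightarrow> 'b::real_vector set) \<Rightarrow> 'a set \<Rightarrow> 'b set \<Rightarrow> 'b set \<Rightarrow> real \<Rightarrow> 'a set" where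
  "eps_efficient f S H K \<epsilon> = {x0 \<in> S. \<exists>y0\<in>f x0.
     (\<lambda>y. y - y0) ` (\<Union>x\<in>S. f x) \<inter> ((*\<^sub>R) (- \<epsilon>) ` H + uminus ` K) = {}}"

definition slm :: "('a::topological_space \<Rightarrow> 'b::real_vector set) \<Rightarrow> 'b set \<Rightarrow> bool" where
  "slm f K \<longleftrightarrow> (\<forall>x :: nat \<Rightarrow> 'a. \<forall>z. x \<longlonglongrightarrow> z \<longrightarrow>
     (\<forall>n. f (x n) \<subseteq> f (x (Suc n)) + K) \<longrightarrow> (\<forall>n. f (x n) \<subseteq> f z + K))"

definition lower_complete :: "('a::metric_space \<Rightarrow> 'b::real_vector set) \<Rightarrow> 'b set \<Rightarrow> bool" where
  "lower_complete f K \<longleftrightarrow> (\<forall>x :: nat \<Rightarrow> 'a. Cauchy x \<longrightarrow>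
     (\<forall>n. f (x n) \<subseteq> f (x (Suc n)) + K) \<longrightarrow> convergent x)"

end

theory Submission
  imports Defs
begin

text \<open>Write \<open>L x\<close> for the set of all \<open>x'\<close> in \<open>S\<close> with
  \<open>f x \<subseteq> f x' + (\<gamma> * dist x x') H + K\<close>. Claim (a) says \<open>z \<in> L x0\<close> and claim (b) says
  \<open>L z \<subseteq> {z}\<close>, so a minimal point of a transitive relation is wanted. Transitivity is the
  triangle inequality combined with two rules for the sets \<open>t H + K\<close>: they add up,
  because \<open>H + K\<close> is convex, and they shrink as \<open>t\<close> grows, because \<open>H \<subseteq> K\<close>.

  A descending sequence \<open>x (Suc n) \<in> L (x n)\<close> is Cauchy because its path length is finite:
  adding up the steps puts the point \<open>y0\<close> that witnesses \<open>\<epsilon>\<close>-efficiency into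
  \<open>f (x n) + (\<gamma> s) H + K\<close>, where \<open>s\<close> is the length of the path from \<open>x0\<close> to \<open>x n\<close>, and this
  is impossible once \<open>\<gamma> s \<ge> \<epsilon>\<close>. So path lengths are at most \<open>\<epsilon> / \<gamma>\<close>, which gives (c) as
  well. The sequence therefore converges to some \<open>z\<close> in \<open>S\<close>, and monotonicity together with
  the previous rules gives, for every \<open>m \<ge> n\<close>,
  \<open>f (x n) \<subseteq> f z + (\<gamma> * dist (x n) (x m)) H + K\<close>.

  It remains to let \<open>m\<close> tend to infinity in the scalar, and here compactness enters
  (\<open>closed_scaling_parameters\<close>): for weakly compact \<open>A\<close> and \<open>B\<close>, the scalars \<open>t\<close> with
  \<open>y \<in> A + t B + K\<close> form a closed set, provided that \<open>K\<close> is weakly closed. The latter is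
  Mazur's theorem, proved below from the Hahn-Banach theorem. Hence descending sequences
  have limits below all their members, and a sequence of nearly maximal steps ends at a
  minimal point (\<open>minimal_point_of_transitive_family\<close>).\<close>

section \<open>The Hahn-Banach theorem for sublinear functionals\<close>

text \<open>Inequality in the homogeneity clause suffices: scaling back by the inverse factor gives
  equality, see \<open>sublinear_scaleR\<close>.\<close>

definition sublinear :: "('b::real_vector \<Rightarrow> real) \<Rightarrow> bool" where
  "sublinear q \<longleftrightarrow> (\<forall>x y. q (x + y) \<le> q x + q y) \<and> (\<forall>c>0. \<forall>x. q (c *\<^sub>R x) \<le> c * q x)"

lemma sublinearI:
  assumes "\<And>x y. q (x + y) \<le> q x + q y" and "\<And>c x. c > 0 \<Longrightarrow> q (c *\<^sub>R x) \<le> c * q x"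
  shows "sublinear q"
  using assms by (simp add: sublinear_def)

lemma sublinear_add: "sublinear q \<Longrightarrow> q (x + y) \<le> q x + q y"
  by (simp add: sublinear_def)

lemma sublinear_zero:
  assumes "sublinear q"
  shows "q 0 = 0"
proof -
  have "q ((1/2) *\<^sub>R 0) \<le> (1/2) * q 0" "q (2 *\<^sub>R 0) \<le> 2 * q 0"
    using assms unfolding sublinear_def by (metis half_gt_zero_iff zero_less_one, metis zero_less_numeral)
  then show ?thesis by simp
qed

lemma sublinear_scaleR:
  assumes "sublinear q" "c \<ge> 0"
  shows "q (c *\<^sub>R x) = c * q x"
proof (cases "c = 0")
  case True
  then show ?thesis using sublinear_zero[OF assms(1)] by simp
next
  case False
  then have c: "c > 0" using assms(2) by simp
  have "q (inverse c *\<^sub>R (c *\<^sub>R x)) \<le> inverse c * q (c *\<^sub>R x)"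
    using assms(1) c unfolding sublinear_def by (meson positive_imp_inverse_positive)
  then have "c * q x \<le> q (c *\<^sub>R x)"
    using c by (simp add: field_simps)
  moreover have "q (c *\<^sub>R x) \<le> c * q x"
    using assms(1) c by (simp add: sublinear_def)
  ultimately show ?thesis by simp
qed

lemma sublinear_minus:
  assumes "sublinear q"
  shows "- q (- x) \<le> q x"
  using sublinear_add[OF assms, of x "- x"] sublinear_zero[OF assms] by simp

text \<open>Forcing the value at \<open>- y\<close> down to \<open>- q y\<close> serves two purposes: it makes minimal
  sublinear functionals odd, and it prescribes the value of a linear minorant at \<open>y\<close>. The
  infimum in the proof is the largest sublinear functional that satisfies both bounds, since
  such an \<open>s\<close> has \<open>s x \<le> s (x + t *\<^sub>R y) + t * s (- y)\<close>.\<close>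

lemma sublinear_minorant_at:
  fixes q :: "'b::real_vector \<Rightarrow> real"
  assumes q: "sublinear q"
  obtains r where "sublinear r" "r \<le> q" "r (- y) \<le> - q y"
proof -
  define r where "r x = (INF t\<in>{0..}. q (x + t *\<^sub>R y) - t * q y)" for x
  have lower: "- q (- x) \<le> q (x + t *\<^sub>R y) - t * q y" if "t \<ge> 0" for x t
    using sublinear_add[OF q, of "x + t *\<^sub>R y" "- x"] sublinear_scaleR[OF q that, of y] by simp
  have bdd: "bdd_below ((\<lambda>t. q (x + t *\<^sub>R y) - t * q y) ` {0..})" for x
    using lower by (intro bdd_belowI2[of _ "- q (- x)"]) simp
  have le: "r x \<le> q (x + t *\<^sub>R y) - t * q y" if "t \<ge> 0" for x t
    unfolding r_def by (rule cINF_lower[OF bdd]) (use that in simp)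
  have ge: "m \<le> r x" if "\<And>t. t \<ge> 0 \<Longrightarrow> m \<le> q (x + t *\<^sub>R y) - t * q y" for m x
    unfolding r_def by (rule cINF_greatest) (use that in auto)
  have "sublinear r"
  proof (rule sublinearI)
    fix x x'
    have step: "r (x + x') \<le> (q (x + s *\<^sub>R y) - s * q y) + (q (x' + t *\<^sub>R y) - t * q y)"
      if "s \<ge> 0" "t \<ge> 0" for s t
      using le[of "s + t" "x + x'"] sublinear_add[OF q, of "x + s *\<^sub>R y" "x' + t *\<^sub>R y"] that
      by (simp add: algebra_simps)
    have "r (x + x') - (q (x + s *\<^sub>R y) - s * q y) \<le> r x'" if "s \<ge> 0" for s
      using step[OF that] by (intro ge) (simp add: algebra_simps)
    then have "r (x + x') - r x' \<le> r x"
      by (intro ge) (simp add: algebra_simps)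
    then show "r (x + x') \<le> r x + r x'" by simp
  next
    fix c :: real and x
    assume c: "c > 0"
    have "r (c *\<^sub>R x) / c \<le> q (x + t *\<^sub>R y) - t * q y" if "t \<ge> 0" for t
    proof -
      have "r (c *\<^sub>R x) \<le> q (c *\<^sub>R (x + t *\<^sub>R y)) - (c * t) * q y"
        using le[of "c * t" "c *\<^sub>R x"] that c by (simp add: scaleR_add_right)
      then show ?thesis
        using c sublinear_scaleR[OF q, of c "x + t *\<^sub>R y"] by (simp add: field_simps)
    qed
    then have "r (c *\<^sub>R x) / c \<le> r x" by (rule ge)
    then show "r (c *\<^sub>R x) \<le> c * r x" using c by (simp add: field_simps)
  qed
  moreover have "r \<le> q"
    using le[of 0] by (simp add: le_fun_def)
  moreover have "r (- y) \<le> - q y"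
    using le[of 1 "- y"] sublinear_zero[OF q] by simp
  ultimately show ?thesis by (rule that)
qed

text \<open>The pointwise infimum of the chain is finite because every sublinear \<open>q \<le> p\<close> has
  \<open>- p (- x) \<le> q x\<close>; it is subadditive because two members of a chain have a smaller one.\<close>

lemma sublinear_chain_Inf:
  fixes p :: "'b::real_vector \<Rightarrow> real"
  assumes "C \<noteq> {}" and sub: "\<And>q. q \<in> C \<Longrightarrow> sublinear q \<and> q \<le> p"
    and chain: "\<And>q r. q \<in> C \<Longrightarrow> r \<in> C \<Longrightarrow> q \<le> r \<or> r \<le> q"
  shows "\<exists>u. sublinear u \<and> u \<le> p \<and> (\<forall>q\<in>C. u \<le> q)"
proof -
  define u where "u x = (INF q\<in>C. q x)" for x
  have bdd: "bdd_below ((\<lambda>q. q x) ` C)" for x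
  proof (intro bdd_belowI2[of _ "- p (- x)"])
    fix q assume "q \<in> C"
    then show "- p (- x) \<le> q x"
      using sub[of q] sublinear_minus[of q x] by (simp add: le_fun_def) (smt (verit))
  qed
  have le: "u x \<le> q x" if "q \<in> C" for x q
    unfolding u_def by (rule cINF_lower[OF bdd that])
  have ge: "m \<le> u x" if "\<And>q. q \<in> C \<Longrightarrow> m \<le> q x" for m x
    unfolding u_def using assms(1) that by (rule cINF_greatest)
  have "sublinear u"
  proof (rule sublinearI)
    fix x y
    have step: "u (x + y) \<le> q x + r y" if "q \<in> C" "r \<in> C" for q r
    proof -
      obtain s where s: "s \<in> C" "s \<le> q" "s \<le> r"
        using chain \<open>q \<in> C\<close> \<open>r \<in> C\<close> order_refl by metis
      have "u (x + y) \<le> s x + s y"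
        using le[OF s(1)] sub[OF s(1)] sublinear_add order_trans by blast
      then show ?thesis
        using s by (smt (verit) le_fun_def)
    qed
    have "u (x + y) - q x \<le> u y" if "q \<in> C" for q
      using step[OF that] by (intro ge) (simp add: algebra_simps)
    then have "u (x + y) - u y \<le> u x"
      by (intro ge) (simp add: algebra_simps)
    then show "u (x + y) \<le> u x + u y" by simp
  next
    fix c :: real and x
    assume c: "c > 0"
    have "u (c *\<^sub>R x) / c \<le> q x" if "q \<in> C" for q
      using le[OF that, of "c *\<^sub>R x"] sublinear_scaleR[of q c x] sub[OF that] c
      by (simp add: field_simps)
    then have "u (c *\<^sub>R x) / c \<le> u x" by (rule ge)
    then show "u (c *\<^sub>R x) \<le> c * u x" using c by (simp add: field_simps)
  qed
  moreover have "u \<le> p"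
    using assms(1) le sub by (fastforce simp: le_fun_def intro: order_trans)
  ultimately show ?thesis
    using le by (auto simp: le_fun_def)
qed

text \<open>A sublinear functional that is minimal for the pointwise order is odd, because its
  minorants from \<open>sublinear_minorant_at\<close> cannot lie strictly below it; an odd subadditive
  functional is additive.\<close>

lemma linear_minorant:
  fixes p :: "'b::real_vector \<Rightarrow> real"
  assumes p: "sublinear p"
  shows "\<exists>l. linear l \<and> l \<le> p"
proof -
  define A where "A = {q. sublinear q \<and> q \<le> p}"
  have "\<exists>m\<in>A. \<forall>a\<in>A. m \<ge> a \<longrightarrow> a = m"
  proof (rule predicate_Zorn)
    show "partial_order_on A (relation_of (\<ge>) A)"
      by (rule partial_order_on_relation_ofI) auto
  next
    fix C assume C: "C \<in> Chains (relation_of (\<ge>) A)"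
    show "\<exists>u\<in>A. \<forall>a\<in>C. a \<ge> u"
    proof (cases "C = {}")
      case True
      then show ?thesis using p by (auto simp: A_def)
    next
      case False
      show ?thesis
        using sublinear_chain_Inf[OF False, of p] C
        unfolding A_def Chains_def relation_of_def by blast
    qed
  qed
  then obtain l where l: "sublinear l" "l \<le> p"
    and minimal: "\<And>q. sublinear q \<Longrightarrow> q \<le> l \<Longrightarrow> q = l"
    unfolding A_def by (auto intro: order_trans)
  have odd: "l (- y) = - l y" for y
  proof -
    obtain r where "sublinear r" "r \<le> l" "r (- y) \<le> - l y"
      using sublinear_minorant_at[OF l(1)] by blast
    then have "l (- y) \<le> - l y" using minimal by blast
    then show ?thesis using sublinear_minus[OF l(1), of y] by simp
  qed
  have "l (x + y) = l x + l y" for x y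
    using sublinear_add[OF l(1), of x y] sublinear_add[OF l(1), of "- x" "- y"]
      odd[of x] odd[of y] odd[of "x + y"] by simp
  moreover have "l (c *\<^sub>R x) = c *\<^sub>R l x" for c x
  proof (cases "c \<ge> 0")
    case True
    then show ?thesis using sublinear_scaleR[OF l(1)] by simp
  next
    case False
    then have "l (c *\<^sub>R x) = - l ((- c) *\<^sub>R x)" using odd[of "(- c) *\<^sub>R x"] by simp
    then show ?thesis using False sublinear_scaleR[OF l(1), of "- c" x] by simp
  qed
  ultimately have "linear l" by (rule linearI)
  then show ?thesis using l(2) by blast
qed

theorem Hahn_Banach_sublinear:
  fixes p :: "'b::real_vector \<Rightarrow> real"
  assumes "sublinear p"
  obtains l where "linear l" "\<And>x. l x \<le> p x" "l y = p y"
proof -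
  obtain r where r: "sublinear r" "r \<le> p" "r (- y) \<le> - p y"
    using sublinear_minorant_at[OF assms] by blast
  obtain l where l: "linear l" "l \<le> r"
    using linear_minorant[OF r(1)] by blast
  have le: "l x \<le> p x" for x
    using l(2) r(2) by (meson le_funD order_trans)
  have "- l y \<le> - p y"
    using l(2) r(3) linear_neg[OF l(1), of y] by (metis le_funD order_trans)
  then show ?thesis
    using that[OF l(1) le] le[of y] by simp
qed

section \<open>Minkowski functionals and weak closedness of closed convex sets\<close>

definition minkowski_functional :: "'b::real_vector set \<Rightarrow> 'b \<Rightarrow> real" where
  "minkowski_functional D x = Inf {t. t > 0 \<and> (1 / t) *\<^sub>R x \<in> D}"

lemma minkowski_le:
  assumes "t > 0" "(1 / t) *\<^sub>R x \<in> D"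
  shows "minkowski_functional D x \<le> t"
  unfolding minkowski_functional_def by (rule cInf_lower) (use assms in \<open>auto intro: bdd_belowI[of _ 0]\<close>)

lemma minkowski_le_one: "x \<in> D \<Longrightarrow> minkowski_functional D x \<le> 1"
  by (rule minkowski_le) auto

lemma sublinear_minkowski:
  fixes D :: "'b::real_vector set"
  assumes D: "convex D" and absorbing: "\<And>x. \<exists>t>0. (1 / t) *\<^sub>R x \<in> D"
  shows "sublinear (minkowski_functional D)"
proof -
  have ge: "m \<le> minkowski_functional D x" if "\<And>t. t > 0 \<Longrightarrow> (1 / t) *\<^sub>R x \<in> D \<Longrightarrow> m \<le> t" for m x
    unfolding minkowski_functional_def by (rule cInf_greatest) (use absorbing[of x] that in auto)
  show ?thesis
  proof (rule sublinearI)
    fix x y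
    have step: "minkowski_functional D (x + y) \<le> s + t"
      if "s > 0" "(1 / s) *\<^sub>R x \<in> D" "t > 0" "(1 / t) *\<^sub>R y \<in> D" for s t
    proof (rule minkowski_le)
      have "(s / (s + t)) *\<^sub>R ((1 / s) *\<^sub>R x) + (t / (s + t)) *\<^sub>R ((1 / t) *\<^sub>R y) \<in> D"
        using that by (intro convexD[OF D]) (auto simp: add_divide_distrib[symmetric])
      moreover have "(s / (s + t)) *\<^sub>R ((1 / s) *\<^sub>R x) + (t / (s + t)) *\<^sub>R ((1 / t) *\<^sub>R y)
          = (1 / (s + t)) *\<^sub>R (x + y)"
        using that by (simp add: scaleR_add_right)
      ultimately show "(1 / (s + t)) *\<^sub>R (x + y) \<in> D" by simp
    qed (use that in simp)
    have "minkowski_functional D (x + y) - s \<le> minkowski_functional D y" if "s > 0" "(1 / s) *\<^sub>R x \<in> D" for s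
      using step[OF that] by (intro ge) (simp add: algebra_simps)
    then have "minkowski_functional D (x + y) - minkowski_functional D y \<le> minkowski_functional D x"
      by (intro ge) (simp add: algebra_simps)
    then show "minkowski_functional D (x + y) \<le> minkowski_functional D x + minkowski_functional D y" by simp
  next
    fix c :: real and x
    assume c: "c > 0"
    have "minkowski_functional D (c *\<^sub>R x) / c \<le> t" if "t > 0" "(1 / t) *\<^sub>R x \<in> D" for t
      using minkowski_le[of "c * t" "c *\<^sub>R x" D] that c by (simp add: field_simps)
    then have "minkowski_functional D (c *\<^sub>R x) / c \<le> minkowski_functional D x" by (rule ge)
    then show "minkowski_functional D (c *\<^sub>R x) \<le> c * minkowski_functional D x" using c by (simp add: field_simps)
  qed
qed

lemma minkowski_ge_one:
  fixes D :: "'b::real_vector set"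
  assumes D: "convex D" "0 \<in> D" "x \<notin> D" and absorbing: "\<exists>t>0. (1 / t) *\<^sub>R x \<in> D"
  shows "1 \<le> minkowski_functional D x"
  unfolding minkowski_functional_def
proof (rule cInf_greatest)
  fix t assume t: "t \<in> {t. t > 0 \<and> (1 / t) *\<^sub>R x \<in> D}"
  show "1 \<le> t"
  proof (rule ccontr)
    assume "\<not> 1 \<le> t"
    then have "t *\<^sub>R ((1 / t) *\<^sub>R x) + (1 - t) *\<^sub>R 0 \<in> D"
      using t D by (intro convexD) auto
    then show False using t D(3) by simp
  qed
qed (use absorbing in auto)

lemma continuous_on_scaleR_lcs:
  fixes g :: "'t::topological_space \<Rightarrow> 'b::locally_convex_space" and c :: "'t \<Rightarrow> real"
  assumes "continuous_on T c" "continuous_on T g"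
  shows "continuous_on T (\<lambda>x. c x *\<^sub>R g x)"
  unfolding continuous_on_def
proof
  fix x assume x: "x \<in> T"
  have "LIM y (at x within T). (c y, g y) :> nhds (c x) \<times>\<^sub>F nhds (g x)"
    using assms x unfolding continuous_on_def by (auto intro: filterlim_Pair)
  from filterlim_compose[OF tendsto_scaleR_nhds_Pair this]
  show "((\<lambda>x. c x *\<^sub>R g x) \<longlongrightarrow> c x *\<^sub>R g x) (at x within T)" by simp
qed

lemma open_nhds_zero_absorbing:
  fixes V :: "'b::locally_convex_space set"
  assumes "open V" "0 \<in> V"
  shows "\<exists>t>0. (1 / t) *\<^sub>R x \<in> V"
proof -
  have "continuous_on UNIV (\<lambda>s::real. s *\<^sub>R x)"
    by (intro continuous_on_scaleR_lcs continuous_intros)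
  then have "open ((\<lambda>s::real. s *\<^sub>R x) -` V)"
    using assms(1) by (rule open_vimage[rotated])
  moreover have "0 \<in> (\<lambda>s::real. s *\<^sub>R x) -` V" using assms(2) by simp
  ultimately obtain e where e: "e > 0" "ball 0 e \<subseteq> (\<lambda>s::real. s *\<^sub>R x) -` V"
    by (meson open_contains_ball)
  then have "(e / 2) *\<^sub>R x \<in> V" by (auto simp: subset_iff)
  then show ?thesis
    using e(1) by (intro exI[of _ "2 / e"]) auto
qed

lemma continuous_linear_bounded_nhds:
  fixes l :: "'b::locally_convex_space \<Rightarrow> real"
  assumes l: "linear l" and V: "open V" "0 \<in> V" "\<And>v. v \<in> V \<Longrightarrow> \<bar>l v\<bar> \<le> 1"
  shows "continuous_on UNIV l"
proof (rule continuous_on_open_vimage[THEN iffD2, OF open_UNIV], intro allI impI)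
  fix B :: "real set" assume B: "open B"
  show "open (l -` B \<inter> UNIV)"
  proof (subst open_subopen, intro ballI)
    fix x assume "x \<in> l -` B \<inter> UNIV"
    then obtain e where e: "e > 0" "ball (l x) e \<subseteq> B"
      using B by (auto elim: openE)
    define W where "W = (\<lambda>y. (2 / e) *\<^sub>R (y - x)) -` V"
    have "open W"
      unfolding W_def by (intro open_vimage V continuous_on_scaleR_lcs continuous_intros)
    moreover have "x \<in> W" using V(2) by (simp add: W_def)
    moreover have "l y \<in> B" if "y \<in> W" for y
    proof -
      have "\<bar>(2 / e) * (l y - l x)\<bar> \<le> 1"
        using V(3)[of "(2 / e) *\<^sub>R (y - x)"] that unfolding W_def
        by (simp only: vimage_eq linear_cmul[OF l] linear_diff[OF l] real_scaleR_def)
      then have "\<bar>l y - l x\<bar> < e"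
        using e(1) by (simp only: abs_mult) (simp add: field_simps)
      then show ?thesis using e(2) by (auto simp: dist_real_def subset_iff)
    qed
    ultimately show "\<exists>W. open W \<and> x \<in> W \<and> W \<subseteq> l -` B \<inter> UNIV" by blast
  qed
qed

text \<open>The functional \<open>l\<close> is dominated by the Minkowski functional of \<open>C - a + V\<close>, where \<open>a \<in> C\<close> and \<open>V\<close> is a small
  symmetric convex neighbourhood of the origin; this bounds it on \<open>V\<close>, whence
  its continuity.\<close>

lemma separate_point_closed_convex:
  fixes C :: "'b::locally_convex_space set"
  assumes C: "closed C" "convex C" "C \<noteq> {}" and y: "y \<notin> C"
  obtains l :: "'b \<Rightarrow> real" and b where "linear l" "continuous_on UNIV l"
    "l y > b" "\<And>c. c \<in> C \<Longrightarrow> l c \<le> b"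
proof -
  obtain a where a: "a \<in> C" using C(3) by blast
  have "open ((\<lambda>v. y + v) -` (- C))"
    using C(1) by (intro open_vimage continuous_intros) auto
  moreover have "0 \<in> (\<lambda>v. y + v) -` (- C)" using y by simp
  ultimately obtain V0 where V0: "open V0" "convex V0" "0 \<in> V0" "V0 \<subseteq> (\<lambda>v. y + v) -` (- C)"
    using convex_nhds_base by meson
  define V where "V = V0 \<inter> uminus -` V0"
  have Vopen: "open V"
    unfolding V_def by (intro open_Int open_vimage V0 continuous_intros)
  have Vconv: "convex V"
    unfolding V_def using V0(2)
    by (intro convex_Int convex_linear_vimage linear_uminus) auto
  have V0': "0 \<in> V" and Vsym: "\<And>v. v \<in> V \<Longrightarrow> - v \<in> V"
    using V0(3) by (auto simp: V_def)
  have Vdisj: "y + v \<notin> C" if "v \<in> V" for v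
    using that V0(4) by (auto simp: V_def)
  define D where "D = {c - a + v | c v. c \<in> C \<and> v \<in> V}"
  have "D = (\<lambda>c. c - a) ` C + V" by (auto simp: D_def set_plus_def)
  moreover have "convex ((\<lambda>c. c - a) ` C + V)"
    using C(2) Vconv by (intro convex_set_plus) (auto simp: convex_translation_subtract)
  ultimately have Dconv: "convex D" by simp
  have VD: "V \<subseteq> D" using a by (force simp: D_def)
  have absorbing: "\<exists>t>0. (1 / t) *\<^sub>R x \<in> D" for x
    using open_nhds_zero_absorbing[OF Vopen V0', of x] VD by blast
  have "y - a \<notin> D"
  proof
    assume "y - a \<in> D"
    then obtain c v where "c \<in> C" "v \<in> V" "y - a = c - a + v" by (auto simp: D_def)
    then show False using Vdisj[OF Vsym[of v]] by simp
  qed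
  then have one: "1 \<le> minkowski_functional D (y - a)"
    using minkowski_ge_one[OF Dconv] V0' VD absorbing by blast
  obtain l where l: "linear l" "\<And>x. l x \<le> minkowski_functional D x" "l (y - a) = minkowski_functional D (y - a)"
    using Hahn_Banach_sublinear[OF sublinear_minkowski[OF Dconv absorbing]] by blast
  have leD: "l x \<le> 1" if "x \<in> D" for x
    using l(2)[of x] minkowski_le_one[OF that] by simp
  have "\<bar>l v\<bar> \<le> 1" if "v \<in> V" for v
    using leD[of v] leD[of "- v"] Vsym[OF that] that VD linear_neg[OF l(1), of v]
    by (auto simp: abs_le_iff)
  then have cont: "continuous_on UNIV l"
    using continuous_linear_bounded_nhds[OF l(1) Vopen V0'] by blast
  obtain t where t: "t > 0" "(1 / t) *\<^sub>R (y - a) \<in> V"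
    using open_nhds_zero_absorbing[OF Vopen V0'] by blast
  \<comment> \<open>The Minkowski functional only gives \<open>l c \<le> l y\<close>; room for strictness comes from moving \<open>c\<close> along a
    vector of \<open>V\<close> on which \<open>l\<close> is positive.\<close>
  define \<delta> where "\<delta> = (1 / t) * l (y - a)"
  have "\<delta> > 0" using t one l(3) by (simp add: \<delta>_def)
  moreover have "l c \<le> l y - \<delta>" if "c \<in> C" for c
  proof -
    have "l (c - a + (1 / t) *\<^sub>R (y - a)) \<le> 1"
      using that t(2) by (intro leD) (auto simp: D_def)
    then have "l (c - a) + \<delta> \<le> l (y - a)"
      using one l(3) by (simp add: linear_add[OF l(1)] linear_cmul[OF l(1)] \<delta>_def)
    then show ?thesis by (simp add: linear_diff[OF l(1)])
  qed
  ultimately show ?thesis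
    using that[OF l(1) cont, of "l y - \<delta>"] by simp
qed

lemma topspace_weak_topology [simp]: "topspace (weak_topology :: 'b::locally_convex_space topology) = UNIV"
proof -
  have "(\<lambda>x::'b. 0::real) -` UNIV \<in> {l -` U | (l :: 'b \<Rightarrow> real) U. linear l \<and> continuous_on UNIV l \<and> open U}"
    by (intro CollectI exI[of _ "\<lambda>x. 0"] exI[of _ UNIV] conjI refl linear_zero) auto
  then show ?thesis
    unfolding weak_topology_def topology_generated_by_topspace by auto
qed

lemma openin_weak_vimage:
  fixes l :: "'b::locally_convex_space \<Rightarrow> real"
  assumes "linear l" "continuous_on UNIV l" "open U"
  shows "openin weak_topology (l -` U)"
  unfolding weak_topology_def by (rule topology_generated_by_Basis) (use assms in blast)

lemma continuous_map_weak_functional: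
  fixes l :: "'b::locally_convex_space \<Rightarrow> real"
  assumes "linear l" "continuous_on UNIV l"
  shows "continuous_map weak_topology euclideanreal l"
  using openin_weak_vimage[OF assms] by (auto simp: continuous_map_def vimage_def)

text \<open>This is Mazur's theorem: separation from a point outside \<open>C\<close> yields a weak half-space
  around that point which misses \<open>C\<close>.\<close>

lemma closedin_weak_closed_convex:
  fixes C :: "'b::locally_convex_space set"
  assumes "closed C" "convex C"
  shows "closedin weak_topology C"
proof (cases "C = {}")
  case False
  have "openin weak_topology (- C)"
  proof (subst openin_subopen, intro ballI)
    fix y assume "y \<in> - C"
    then obtain l :: "'b \<Rightarrow> real" and b where l: "linear l" "continuous_on UNIV l"
      "l y > b" "\<And>c. c \<in> C \<Longrightarrow> l c \<le> b"
      using separate_point_closed_convex[OF assms False] by blast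
    have "openin weak_topology (l -` {b<..})"
      using l by (intro openin_weak_vimage) auto
    moreover have "l -` {b<..} \<subseteq> - C" using l(4) by force
    ultimately show "\<exists>T. openin weak_topology T \<and> y \<in> T \<and> T \<subseteq> - C"
      using l(3) by (intro exI[of _ "l -` {b<..}"]) auto
  qed
  then show ?thesis by (simp add: closedin_def Compl_eq_Diff_UNIV)
qed simp

section \<open>Weak compactness and limits of the scaling factor\<close>

text \<open>The solution set of \<open>y - a - t *\<^sub>R b \<in> K\<close> in \<open>(a, b, t)\<close> is closed for the weak topology,
  and projecting it along the compact factors \<open>A\<close> and \<open>B\<close> is a closed map.\<close>

lemma closed_scaling_parameters:
  fixes A B K :: "'b::locally_convex_space set"
  assumes A: "weakly_compact A" and B: "weakly_compact B" and K: "closed K" "convex K"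
  shows "closed {t::real. y \<in> A + (*\<^sub>R) t ` B + K}"
proof -
  let ?W = "weak_topology :: 'b topology"
  define Z where "Z = prod_topology (subtopology ?W A) (subtopology ?W B)"
  define F where "F = (\<lambda>p :: ('b \<times> 'b) \<times> real. y - fst (fst p) - snd p *\<^sub>R snd (fst p))"
  have "compact_space (subtopology ?W A)" "compact_space (subtopology ?W B)"
    using A B by (auto simp: compactin_subspace)
  then have "compact_space Z"
    by (simp add: Z_def compact_space_prod_topology)
  then have proj: "closed_map (prod_topology Z euclideanreal) euclideanreal snd"
    by (rule closed_map_snd)
  have "continuous_map (prod_topology Z euclideanreal) ?W F"
    unfolding weak_topology_def
  proof (rule continuous_on_generated_topo)
    fix U assume "U \<in> {l -` U | (l :: 'b \<Rightarrow> real) U. linear l \<and> continuous_on UNIV l \<and> open U}"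
    then obtain l :: "'b \<Rightarrow> real" and U' where
      l: "linear l" "continuous_on UNIV l" and U: "open U'" "U = l -` U'" by blast
    have lA: "continuous_map (subtopology ?W A) euclideanreal l"
      and lB: "continuous_map (subtopology ?W B) euclideanreal l"
      using continuous_map_weak_functional[OF l] by (auto intro: continuous_map_from_subtopology)
    have "continuous_map (prod_topology Z euclideanreal) euclideanreal
        (\<lambda>p. l y - (l \<circ> fst \<circ> fst) p - snd p * (l \<circ> snd \<circ> fst) p)"
      unfolding Z_def
      by (intro continuous_map_diff continuous_map_real_mult continuous_map_snd
          continuous_map_compose[OF continuous_map_fst
            continuous_map_compose[OF continuous_map_fst lA]]
          continuous_map_compose[OF continuous_map_fst
            continuous_map_compose[OF continuous_map_snd lB]]) auto
    moreover have "(\<lambda>p. l y - (l \<circ> fst \<circ> fst) p - snd p * (l \<circ> snd \<circ> fst) p) = l \<circ> F"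
      by (auto simp: F_def linear_diff[OF l(1)] linear_cmul[OF l(1)])
    ultimately have "continuous_map (prod_topology Z euclideanreal) euclideanreal (l \<circ> F)"
      by simp
    from openin_continuous_map_preimage[OF this, of U'] U
    show "openin (prod_topology Z euclideanreal)
        (F -` U \<inter> topspace (prod_topology Z euclideanreal))"
      by (simp add: vimage_def Int_def conj_commute)
  qed (use topspace_weak_topology[where 'b='b] in \<open>auto simp: weak_topology_def topology_generated_by_topspace\<close>)
  then have "closedin (prod_topology Z euclideanreal)
      {p \<in> topspace (prod_topology Z euclideanreal). F p \<in> K}"
    using closedin_weak_closed_convex[OF K] by (rule closedin_continuous_map_preimage)
  then have "closedin euclideanreal
      (snd ` {p \<in> topspace (prod_topology Z euclideanreal). F p \<in> K})"
    using proj by (simp add: closed_map_def)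
  moreover have "snd ` {p \<in> topspace (prod_topology Z euclideanreal). F p \<in> K}
      = {t. y \<in> A + (*\<^sub>R) t ` B + K}"
  proof -
    have "y \<in> A + (*\<^sub>R) t ` B + K \<longleftrightarrow> (\<exists>a\<in>A. \<exists>b\<in>B. y - a - t *\<^sub>R b \<in> K)" for t
    proof
      assume "y \<in> A + (*\<^sub>R) t ` B + K"
      then show "\<exists>a\<in>A. \<exists>b\<in>B. y - a - t *\<^sub>R b \<in> K"
        by (auto simp: set_plus_def) (metis add_diff_cancel_left' diff_diff_eq)
    next
      assume "\<exists>a\<in>A. \<exists>b\<in>B. y - a - t *\<^sub>R b \<in> K"
      then obtain a b where ab: "a \<in> A" "b \<in> B" "y - a - t *\<^sub>R b \<in> K" by blast
      then have "a + t *\<^sub>R b + (y - a - t *\<^sub>R b) \<in> A + (*\<^sub>R) t ` B + K"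
        by (intro set_plus_intro) auto
      then show "y \<in> A + (*\<^sub>R) t ` B + K" by simp
    qed
    then show ?thesis
      by (force simp: Z_def F_def image_iff)
  qed
  ultimately show ?thesis by simp
qed

section \<open>Minimal points of a transitive family of sets in a metric space\<close>

lemma Cauchy_bounded_path_length:
  fixes x :: "nat \<Rightarrow> 'a::metric_space"
  assumes "\<And>n. (\<Sum>i<n. dist (x i) (x (Suc i))) \<le> M"
  shows "Cauchy x"
proof -
  let ?s = "\<lambda>n. \<Sum>i<n. dist (x i) (x (Suc i))"
  have "summable (\<lambda>i. dist (x i) (x (Suc i)))"
    using assms by (intro summableI_nonneg_bounded) auto
  then have "Cauchy ?s"
    using summable_iff_convergent convergent_Cauchy by blast
  have step: "dist (x m) (x n) \<le> ?s n - ?s m" if "m \<le> n" for m n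
    using that
  proof (induction n rule: dec_induct)
    case (step n)
    then show ?case using dist_triangle[of "x m" "x (Suc n)" "x n"] by simp
  qed simp
  have "dist (x m) (x n) \<le> dist (?s m) (?s n)" for m n
    using step[of m n] step[of n m] by (cases "m \<le> n") (auto simp: dist_real_def dist_commute)
  then show ?thesis
    using \<open>Cauchy ?s\<close> unfolding Cauchy_def by (meson le_less_trans)
qed

text \<open>Moving at each step at least half as far as \<open>L\<close> allows makes the sets \<open>L (x n)\<close>
  shrink to a point along any such sequence that converges.\<close>

lemma minimal_point_of_transitive_family:
  fixes L :: "'a::metric_space \<Rightarrow> 'a set"
  assumes refl: "x0 \<in> L x0" "\<And>x. x \<in> L x0 \<Longrightarrow> x \<in> L x"
    and trans: "\<And>x y. y \<in> L x \<Longrightarrow> L y \<subseteq> L x"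
    and bounded: "bounded (L x0)"
    and limits: "\<And>x. x 0 = x0 \<Longrightarrow> (\<And>n. x (Suc n) \<in> L (x n)) \<Longrightarrow>
        \<exists>z. x \<longlonglongrightarrow> z \<and> (\<forall>n. z \<in> L (x n))"
  obtains z where "z \<in> L x0" "L z \<subseteq> {z}"
proof -
  have far: "\<exists>y. y \<in> L x \<and> (\<forall>w\<in>L x. dist x w \<le> 2 * dist x y)" if x: "x \<in> L x0" for x
  proof (rule ccontr)
    assume contra: "\<not> ?thesis"
    define s where "s = (SUP w\<in>L x. dist x w)"
    have "bounded (L x)" using bounded trans[OF x] bounded_subset by blast
    then have bdd: "bdd_above (dist x ` L x)"
      by (meson bdd_above.I2 bounded_any_center)
    have le: "dist x w \<le> s" if "w \<in> L x" for w
      unfolding s_def by (rule cSUP_upper[OF that bdd])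
    \<comment> \<open>Reflexivity makes \<open>x\<close> itself a candidate, so some point of \<open>L x\<close> differs from \<open>x\<close>.\<close>
    obtain w where "w \<in> L x" "dist x w > 0"
      using contra refl(2)[OF x] by fastforce
    then have "s > 0" using le[of w] by linarith
    then have "s / 2 < (SUP w\<in>L x. dist x w)" by (simp add: s_def)
    then obtain y where "y \<in> L x" "s / 2 < dist x y"
      using less_cSUP_iff[OF _ bdd] refl(2)[OF x] by blast
    then show False using contra le by fastforce
  qed
  obtain x where x: "x 0 = x0" "\<And>n. x n \<in> L x0"
    and next_in: "\<And>n. x (Suc n) \<in> L (x n)"
    and next_far: "\<And>n w. w \<in> L (x n) \<Longrightarrow> dist (x n) w \<le> 2 * dist (x n) (x (Suc n))"
  proof -
    have "\<exists>x. \<forall>n. (x n \<in> L x0 \<and> (n = 0 \<longrightarrow> x n = x0)) \<and>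
        (x (Suc n) \<in> L (x n) \<and> (\<forall>w\<in>L (x n). dist (x n) w \<le> 2 * dist (x n) (x (Suc n))))"
    proof (rule dependent_nat_choice)
      fix u :: 'a and n :: nat assume "u \<in> L x0 \<and> (n = 0 \<longrightarrow> u = x0)"
      then show "\<exists>y. (y \<in> L x0 \<and> (Suc n = 0 \<longrightarrow> y = x0)) \<and>
          (y \<in> L u \<and> (\<forall>w\<in>L u. dist u w \<le> 2 * dist u y))"
        using far[of u] trans[of u x0] by blast
    qed (use refl in auto)
    then show thesis using that by blast
  qed
  obtain z where z: "x \<longlonglongrightarrow> z" "\<And>n. z \<in> L (x n)"
    using limits[OF x(1) next_in] by blast
  have "w = z" if w: "w \<in> L z" for w
  proof -
    have wn: "w \<in> L (x n)" for n using w trans z(2) by blast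
    have "(\<lambda>n. 2 * dist (x n) (x (Suc n))) \<longlonglongrightarrow> 2 * dist z z"
      by (intro tendsto_intros z(1) LIMSEQ_Suc[OF z(1)])
    moreover have "(\<lambda>n. dist (x n) w) \<longlonglongrightarrow> dist z w"
      by (intro tendsto_intros z(1))
    ultimately have "dist z w \<le> 2 * dist z z"
      using next_far[OF wn] by (intro LIMSEQ_le[of "\<lambda>n. dist (x n) w"]) blast+
    then show ?thesis by simp
  qed
  then show ?thesis using that[of z] z(2)[of 0] x(1) by auto
qed

section \<open>The variational principle\<close>

lemma dilated_plus_cone_antimono:
  fixes H K :: "'b::real_vector set"
  assumes K: "convex_cone K" and "H \<subseteq> K" "0 \<le> b" "b \<le> a"
  shows "(*\<^sub>R) a ` H + K \<subseteq> (*\<^sub>R) b ` H + K"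
proof
  fix y assume "y \<in> (*\<^sub>R) a ` H + K"
  then obtain h k where hk: "h \<in> H" "k \<in> K" "y = a *\<^sub>R h + k" by (auto simp: set_plus_def)
  have "(a - b) *\<^sub>R h + k \<in> K"
    using hk assms by (intro convex_cone_add convex_cone_scaleR) auto
  then have "b *\<^sub>R h + ((a - b) *\<^sub>R h + k) \<in> (*\<^sub>R) b ` H + K"
    using hk by (intro set_plus_intro) auto
  then show "y \<in> (*\<^sub>R) b ` H + K" using hk(3) by (simp add: algebra_simps)
qed

lemma dilated_plus_cone_add:
  fixes H K :: "'b::real_vector set"
  assumes K: "convex_cone K" and HK: "K_convex K H" and "0 \<le> a" "0 \<le> b"
    and u: "u \<in> (*\<^sub>R) a ` H + K" and v: "v \<in> (*\<^sub>R) b ` H + K"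
  shows "u + v \<in> (*\<^sub>R) (a + b) ` H + K"
proof -
  obtain h k where hk: "h \<in> H" "k \<in> K" "u = a *\<^sub>R h + k"
    using u by (auto simp: set_plus_def)
  obtain h' k' where hk': "h' \<in> H" "k' \<in> K" "v = b *\<^sub>R h' + k'"
    using v by (auto simp: set_plus_def)
  have kk: "k + k' \<in> K" using K hk(2) hk'(2) by (rule convex_cone_add)
  show ?thesis
  proof (cases "a + b = 0")
    case True
    then have "a = 0" "b = 0" using assms by auto
    moreover have "0 *\<^sub>R h + (k + k') \<in> (*\<^sub>R) 0 ` H + K"
      using hk kk by (intro set_plus_intro) auto
    ultimately show ?thesis using hk hk' by simp
  next
    case False
    then have pos: "a + b > 0" using assms by auto
    have "0 \<in> K" using K convex_cone_contains_0 by blast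
    then have "h \<in> H + K" "h' \<in> H + K"
      using hk hk' set_plus_intro[of _ H 0 K] by force+
    then have "(a / (a + b)) *\<^sub>R h + (b / (a + b)) *\<^sub>R h' \<in> H + K"
      using HK pos assms unfolding K_convex_def
      by (intro convexD) (auto simp: add_divide_distrib[symmetric])
    then obtain g m where g: "g \<in> H" "m \<in> K"
      and eq: "(a / (a + b)) *\<^sub>R h + (b / (a + b)) *\<^sub>R h' = g + m"
      by (auto simp: set_plus_def)
    have "a *\<^sub>R h + b *\<^sub>R h' = (a + b) *\<^sub>R ((a / (a + b)) *\<^sub>R h + (b / (a + b)) *\<^sub>R h')"
      using pos by (simp add: scaleR_add_right)
    then have "u + v = (a + b) *\<^sub>R g + ((a + b) *\<^sub>R m + (k + k'))"
      unfolding eq using hk hk' by (simp add: algebra_simps)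
    moreover have "(a + b) *\<^sub>R m + (k + k') \<in> K"
      using K g pos by (intro convex_cone_add[OF K _ kk] convex_cone_scaleR) auto
    ultimately show ?thesis
      using g(1) by (auto intro!: set_plus_intro)
  qed
qed

theorem corollary6p8:
  fixes f :: "'a::metric_space \<Rightarrow> 'b::locally_convex_space set"
    and K H :: "'b set" and S :: "'a set" and x0 :: 'a and \<epsilon> \<gamma> :: real
  assumes "pointed_convex_cone K"
    and "H \<subseteq> K" and "H \<noteq> {}" and "K_convex K H" and "0 \<notin> vcl (H + K)"
    and "closed S" and "S \<noteq> {}" and "x0 \<in> S" and "\<epsilon> > 0" and "\<gamma> > 0"
    and i: "lower_complete f K \<or> complete (UNIV :: 'a set)"
    and ii: "x0 \<in> eps_efficient f S H K \<epsilon>"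
    and iii: "slm f K" "\<And>x. weakly_compact (f x)" "weakly_compact H" "closed K"
  shows "\<exists>z\<in>S.
      f x0 \<subseteq> f z + (*\<^sub>R) (\<gamma> * dist x0 z) ` H + K \<and>
      (\<forall>x\<in>S - {z}. \<not> f z \<subseteq> f x + (*\<^sub>R) (\<gamma> * dist z x) ` H + K) \<and>
      dist x0 z \<le> \<epsilon> / \<gamma>"
proof -
  have K: "convex_cone K" using assms(1) by (simp add: pointed_convex_cone_def)
  then have Kconv: "convex K" and K0: "0 \<in> K"
    by (auto simp: convex_cone_def convex_cone_contains_0)
  define P where "P t = (*\<^sub>R) t ` H + K" for t :: real
  have P0: "P 0 = K"
    using \<open>H \<noteq> {}\<close> by (auto simp: P_def set_plus_def)
  have P_antimono: "P a \<subseteq> P b" if "0 \<le> b" "b \<le> a" for a b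
    unfolding P_def using K \<open>H \<subseteq> K\<close> that by (rule dilated_plus_cone_antimono)
  have P_le_K: "P a \<subseteq> K" if "0 \<le> a" for a
    using P_antimono[OF order_refl that] P0 by simp
  have f_antimono: "f x + P a \<subseteq> f x + P b" if "0 \<le> b" "b \<le> a" for x a b
    using P_antimono[OF that] by (simp add: set_plus_mono2)
  have compose: "y \<in> f v + P (a + b)"
    if "f u \<subseteq> f v + P a" "y \<in> f u + P b" "0 \<le> a" "0 \<le> b" for u v y a b
  proof -
    obtain w p where wp: "w \<in> f u" "p \<in> P b" "y = w + p"
      using \<open>y \<in> f u + P b\<close> by (auto simp: set_plus_def)
    then obtain w' p' where wp': "w' \<in> f v" "p' \<in> P a" "w = w' + p'"
      using \<open>f u \<subseteq> f v + P a\<close> by (auto simp: set_plus_def)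
    have "p' + p \<in> P (a + b)"
      using dilated_plus_cone_add[OF K \<open>K_convex K H\<close> \<open>0 \<le> a\<close> \<open>0 \<le> b\<close>] wp(2) wp'(2) by (simp add: P_def)
    then have "w' + (p' + p) \<in> f v + P (a + b)"
      using wp'(1) by (rule set_plus_intro[rotated])
    then show ?thesis using wp(3) wp'(3) by (simp add: add.assoc)
  qed
  obtain y0 where y0: "y0 \<in> f x0"
    and efficient: "(\<lambda>y. y - y0) ` (\<Union>x\<in>S. f x) \<inter> ((*\<^sub>R) (- \<epsilon>) ` H + uminus ` K) = {}"
    using ii by (auto simp: eps_efficient_def)
  have y0_notin: "y0 \<notin> f x + P \<epsilon>" if "x \<in> S" for x
  proof
    assume "y0 \<in> f x + P \<epsilon>"
    then obtain y h k where yhk: "y \<in> f x" "h \<in> H" "k \<in> K" "y0 = y + (\<epsilon> *\<^sub>R h + k)"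
      by (auto simp: P_def set_plus_def)
    then have "(- \<epsilon>) *\<^sub>R h + (- k) \<in> (*\<^sub>R) (- \<epsilon>) ` H + uminus ` K"
      by (intro set_plus_intro) auto
    moreover have "y - y0 = (- \<epsilon>) *\<^sub>R h + (- k)" using yhk(4) by simp
    moreover have "y - y0 \<in> (\<lambda>y. y - y0) ` (\<Union>x\<in>S. f x)" using yhk(1) that by blast
    ultimately show False using efficient by (metis IntI emptyE)
  qed
  have short: "t \<le> \<epsilon> / \<gamma>" if "x \<in> S" "y0 \<in> f x + P (\<gamma> * t)" for x t
  proof (rule ccontr)
    assume "\<not> t \<le> \<epsilon> / \<gamma>"
    then have "\<epsilon> \<le> \<gamma> * t" using \<open>\<gamma> > 0\<close> by (simp add: field_simps)
    then show False
      using f_antimono[of \<epsilon> "\<gamma> * t" x] that y0_notin[of x] \<open>\<epsilon> > 0\<close> by auto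
  qed
  define L where "L x = {x' \<in> S. f x \<subseteq> f x' + P (\<gamma> * dist x x')}" for x
  have L_self: "x \<in> L x" if "x \<in> S" for x
    using that K0 set_plus_intro[of _ "f x" 0 K] P0 by (force simp: L_def)
  have L_trans: "L x' \<subseteq> L x" if x': "x' \<in> L x" for x x'
  proof
    fix x'' assume x'': "x'' \<in> L x'"
    have "f x \<subseteq> f x'' + P (\<gamma> * dist x x'')"
    proof
      fix y assume "y \<in> f x"
      then have "y \<in> f x'' + P (\<gamma> * dist x' x'' + \<gamma> * dist x x')"
        using x' x'' \<open>\<gamma> > 0\<close> by (intro compose) (auto simp: L_def)
      moreover have "\<gamma> * dist x x'' \<le> \<gamma> * dist x' x'' + \<gamma> * dist x x'"
        using dist_triangle[of x x'' x'] \<open>\<gamma> > 0\<close>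
        by (simp flip: distrib_left add: add.commute)
      ultimately show "y \<in> f x'' + P (\<gamma> * dist x x'')"
        using f_antimono \<open>\<gamma> > 0\<close> by (meson subsetD mult_nonneg_nonneg less_imp_le zero_le_dist)
    qed
    then show "x'' \<in> L x" using x'' by (simp add: L_def)
  qed
  have L_dist: "dist x0 x \<le> \<epsilon> / \<gamma>" if "x \<in> L x0" for x
    using short[of x "dist x0 x"] that y0 by (auto simp: L_def)
  have L_step_K: "f x \<subseteq> f x' + K" if "x' \<in> L x" for x x'
    using that f_antimono[of 0 "\<gamma> * dist x x'" x'] P0 \<open>\<gamma> > 0\<close> by (force simp: L_def)
  obtain z where z: "z \<in> L x0" "L z \<subseteq> {z}"
  proof (rule minimal_point_of_transitive_family[of x0 L])
    show "x0 \<in> L x0" using L_self \<open>x0 \<in> S\<close> by blast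
    show "x \<in> L x" if "x \<in> L x0" for x using that L_self by (auto simp: L_def)
    show "L y \<subseteq> L x" if "y \<in> L x" for x y using L_trans[OF that] .
    show "bounded (L x0)" using L_dist by (auto simp: bounded_def)
  next
    fix x :: "nat \<Rightarrow> 'a"
    assume x: "x 0 = x0" "\<And>n. x (Suc n) \<in> L (x n)"
    have xS: "x n \<in> S" for n
      using x \<open>x0 \<in> S\<close> by (cases n) (auto simp: L_def)
    have down: "f (x n) \<subseteq> f (x (Suc n)) + K" for n
      using L_step_K x(2) by blast
    \<comment> \<open>The whole path length, not only the distance from \<open>x0\<close>, is controlled by the dilation
      factor that separates \<open>y0\<close> from \<open>f (x n)\<close>.\<close>
    have "y0 \<in> f (x n) + P (\<gamma> * (\<Sum>i<n. dist (x i) (x (Suc i))))" for n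
    proof (induction n)
      case 0
      then show ?case using y0 x(1) P0 K0 set_plus_intro[of y0 "f x0" 0 K] by simp
    next
      case (Suc n)
      then have "y0 \<in> f (x (Suc n)) + P (\<gamma> * dist (x n) (x (Suc n))
          + \<gamma> * (\<Sum>i<n. dist (x i) (x (Suc i))))"
        using x(2)[of n] \<open>\<gamma> > 0\<close> by (intro compose) (auto simp: L_def sum_nonneg)
      then show ?case by (simp add: algebra_simps)
    qed
    then have "(\<Sum>i<n. dist (x i) (x (Suc i))) \<le> \<epsilon> / \<gamma>" for n
      using short[OF xS] by blast
    then have "Cauchy x" by (rule Cauchy_bounded_path_length)
    then have "convergent x"
      using i down unfolding lower_complete_def complete_def convergent_def by blast
    then obtain z where z: "x \<longlonglongrightarrow> z" by (auto simp: convergent_def)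
    then have zS: "z \<in> S" using \<open>closed S\<close> xS closed_sequentially by blast
    have fz: "f (x n) \<subseteq> f z + K" for n
      using iii(1) z down unfolding slm_def by blast
    have xm: "x m \<in> L (x n)" if "n \<le> m" for m n
      using that
    proof (induction m rule: dec_induct)
      case base
      then show ?case using L_self xS by blast
    next
      case (step m)
      then show ?case using L_trans x(2) by blast
    qed
    have "z \<in> L (x n)" for n
    proof -
      have "f (x n) \<subseteq> f z + P (\<gamma> * dist (x n) z)"
      proof
        fix y assume y: "y \<in> f (x n)"
        let ?T = "{t::real. y \<in> f z + (*\<^sub>R) t ` H + K}"
        have "closed ?T"
          using closed_scaling_parameters[OF iii(2,3,4) Kconv] .
        moreover have "\<gamma> * dist (x n) (x (m + n)) \<in> ?T" for m
        proof -
          have "y \<in> f (x (m + n)) + P (\<gamma> * dist (x n) (x (m + n)))"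
            using xm[of n "m + n"] y by (auto simp: L_def)
          then have "y \<in> f z + P (0 + \<gamma> * dist (x n) (x (m + n)))"
            using fz \<open>\<gamma> > 0\<close> P0 by (intro compose) auto
          then show ?thesis by (simp add: P_def add.assoc)
        qed
        moreover have "(\<lambda>m. \<gamma> * dist (x n) (x (m + n))) \<longlonglongrightarrow> \<gamma> * dist (x n) z"
          by (intro tendsto_intros LIMSEQ_ignore_initial_segment z)
        ultimately have "\<gamma> * dist (x n) z \<in> ?T"
          by (rule closed_sequentially)
        then show "y \<in> f z + P (\<gamma> * dist (x n) z)" by (simp add: P_def add.assoc)
      qed
      then show ?thesis using zS by (simp add: L_def)
    qed
    then show "\<exists>z. x \<longlonglongrightarrow> z \<and> (\<forall>n. z \<in> L (x n))" using z by blast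
  qed
  show ?thesis
  proof (intro bexI conjI ballI)
    show "z \<in> S" using z(1) by (simp add: L_def)
    show "f x0 \<subseteq> f z + (*\<^sub>R) (\<gamma> * dist x0 z) ` H + K"
      using z(1) by (simp add: L_def P_def add.assoc)
    show "dist x0 z \<le> \<epsilon> / \<gamma>" using L_dist z(1) by blast
    show "\<not> f z \<subseteq> f x + (*\<^sub>R) (\<gamma> * dist z x) ` H + K" if "x \<in> S - {z}" for x
      using that z(2) by (auto simp: L_def P_def add.assoc)
  qed
qed

end
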